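(* Let $K$ be a field of characteristic not equal to $2$, let $f(z)=z^2+c\in K[z]$ with $0$ not periodic and $f^r(0)=-f(0)$ for a minimal $r>1$; assume $r\ge3$. Let $x_0\in K$ not lie in the forward orbit $\{f^i(0):i\ge0\}$ of $0$, and fix a choice of $\sqrt2\in\overline K$. For a labeling of the preimage tree of $x_0$ and a word $y$, let $E_y=\prod_{w'\in\{a,b\}^{r-2}}[yw'a]$. Suppose the labeling satisfies, for every word $x$, $$E_{xaa}E_{xab}=[xba],\qquad E_{xba}E_{xbb}=[xaa],$$ $$\frac{E_{xaa}+E_{xab}}{E_{xbb}}=\frac{E_{xab}-E_{xaa}}{E_{xba}}=\frac{E_{xba}+E_{xbb}}{E_{xab}}=\frac{E_{xbb}-E_{xba}}{E_{xaa}}=\sqrt2$$ (such a labeling exists). Then for every node $x$ and every $\sigma\in G_\infty=\mathrm{Gal}(K_\infty/K)$, $$P^a_{r,1}(\sigma,x)=P^b_{r,1}(\sigma,x)=0\quad\text{and}\quad\sigma(\sqrt2)=(-1)^{R_{r,1}(\sigma,x)}\sqrt2.$$ In particular, the image of $G_\infty$ in $\mathrm{Aut}(T_\infty)$ induced by this labeling is contained in $\tilde M_{r,1,\infty}$. Furthermore, if $\sqrt2\in K$, then this image is contained in $\tilde B_{r,1,\infty}$.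
   Context: Labeling: assign to each word $w$ in $\{a,b\}$ of length $n$ a point $[w]\in f^{-n}(x_0)\subset\overline K$ with $[\,]=x_0$, bijectively on each level, such that $[wa],[wb]=-[wa]$ are the two roots of $f(z)=[w]$. $K_\infty=\bigcup_nK(f^{-n}(x_0))$; $\sigma\in G_\infty$ acts on words by $[\sigma(w)]=\sigma([w])$, giving $G_\infty\to\mathrm{Aut}(T_\infty)$ ($T_\infty$ the binary rooted tree of words). $\mathrm{Par}(\sigma,x)\in\mathbb{Z}/2\mathbb{Z}$ is $0$ if $\sigma(xa)=\sigma(x)a$, $1$ otherwise. $P^a_{r,1}(\sigma,x)=\mathrm{Par}(\sigma,xb)+\sum_{w\in\{a,b\}^{r-1}}\mathrm{Par}(\sigma,xaw)$, $P^b_{r,1}(\sigma,x)=\mathrm{Par}(\sigma,xa)+\sum_{w\in\{a,b\}^{r-1}}\mathrm{Par}(\sigma,xbw)$ (mod 2); $M_{r,1,\infty}$ = set of $\sigma$ with all these values over all nodes equal (common value $P_{r,1}(\sigma)$), $B_{r,1,\infty}=\{P_{r,1}=0\}$. $R_{r,1}(\sigma,x)=\mathrm{Par}(\sigma,xa)\mathrm{Par}(\sigma,xb)+\sum_{w\in\{a,b\}^{r-2}}(\mathrm{Par}(\sigma,xabw)+\mathrm{Par}(\sigma,xbbw))$ mod 2. $\tilde M_{r,1,\infty}=\{\sigma\in B_{r,1,\infty}:R_{r,1}(\sigma,x)\text{ independent of }x\}$ with common value $R_{r,1}(\sigma)$; $\tilde B_{r,1,\infty}=\{\sigma\in\tilde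 M_{r,1,\infty}:R_{r,1}(\sigma)=0\}$. *)

theory Defs
  imports "HOL-Algebra.Algebraic_Closure_Type" "HOL-Algebra.Generated_Fields" 
    "HOL-Library.Z2" "HOL-Library.FuncSet"
begin

text \<open>
  The field $K$ is the type \<^typ>\<open>'k\<close> (of class \<^class>\<open>field\<close>), its algebraic closure is
  \<^typ>\<open>'k alg_closure\<close>, and \<^const>\<open>to_ac\<close> is the inclusion.  Nodes of the binary rooted tree
  are words; the children of a node \<open>w\<close> are obtained by appending a letter on the right.
\<close>

datatype letter = La | Lb

type_synonym word = "letter list"

definition words :: "nat \<Rightarrow> word set" where
  "words n = {w. length w = n}"


subsection \<open>Automorphisms of the tree\<close>

definition tree_auts :: "(word \<Rightarrow> word) set" where
  "tree_auts = {g. bij g \<and> g [] = [] \<and> (\<forall>w l. \<exists>l'. g (w @ [l]) = g w @ [l'])}"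

definition Par :: "(word \<Rightarrow> word) \<Rightarrow> word \<Rightarrow> bit" where
  "Par g x = (if g (x @ [La]) = g x @ [La] then 0 else 1)"

definition Pa :: "nat \<Rightarrow> (word \<Rightarrow> word) \<Rightarrow> word \<Rightarrow> bit" where
  "Pa r g x = Par g (x @ [Lb]) + (\<Sum>w\<in>words (r - 1). Par g (x @ [La] @ w))"

definition Pb :: "nat \<Rightarrow> (word \<Rightarrow> word) \<Rightarrow> word \<Rightarrow> bit" where
  "Pb r g x = Par g (x @ [La]) + (\<Sum>w\<in>words (r - 1). Par g (x @ [Lb] @ w))"

definition M_grp :: "nat \<Rightarrow> (word \<Rightarrow> word) set" where
  "M_grp r = {g \<in> tree_auts. \<exists>p. \<forall>x. Pa r g x = p \<and> Pb r g x = p}"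

text \<open>Only meaningful on \<^term>\<open>M_grp r\<close>, where the common value exists.\<close>

definition P_common :: "nat \<Rightarrow> (word \<Rightarrow> word) \<Rightarrow> bit" where
  "P_common r g = (THE p. \<forall>x. Pa r g x = p \<and> Pb r g x = p)"

definition B_grp :: "nat \<Rightarrow> (word \<Rightarrow> word) set" where
  "B_grp r = {g \<in> M_grp r. P_common r g = 0}"

definition Rval :: "nat \<Rightarrow> (word \<Rightarrow> word) \<Rightarrow> word \<Rightarrow> bit" where
  "Rval r g x = Par g (x @ [La]) * Par g (x @ [Lb])
     + (\<Sum>w\<in>words (r - 2). Par g (x @ [La, Lb] @ w) + Par g (x @ [Lb, Lb] @ w))"

definition M_tilde :: "nat \<Rightarrow> (word \<Rightarrow> word) set" where
  "M_tilde r = {g \<in> B_grp r. \<exists>p. \<forall>x. Rval r g x = p}"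

text \<open>Only meaningful on \<^term>\<open>M_tilde r\<close>, where the common value exists.\<close>

definition R_common :: "nat \<Rightarrow> (word \<Rightarrow> word) \<Rightarrow> bit" where
  "R_common r g = (THE p. \<forall>x. Rval r g x = p)"

definition B_tilde :: "nat \<Rightarrow> (word \<Rightarrow> word) set" where
  "B_tilde r = {g \<in> M_tilde r. R_common r g = 0}"


subsection \<open>The preimage tree, its labelings, and the Galois action\<close>

definition f_ac :: "'k::field poly \<Rightarrow> 'k alg_closure \<Rightarrow> 'k alg_closure" where
  "f_ac f = poly (map_poly to_ac f)"

definition preimages :: "'k::field poly \<Rightarrow> 'k \<Rightarrow> nat \<Rightarrow> 'k alg_closure set" where
  "preimages f x0 n = {z. (f_ac f ^^ n) z = to_ac x0}"

text \<open>
  A point may lie on several levels (when \<open>x0\<close> is periodic), so a labeling is required to be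
  bijective on each level only.
\<close>

definition is_labeling ::
    "'k::field poly \<Rightarrow> 'k \<Rightarrow> (word \<Rightarrow> 'k alg_closure) \<Rightarrow> bool" where
  "is_labeling f x0 lab \<longleftrightarrow>
     lab [] = to_ac x0 \<and>
     (\<forall>n. bij_betw lab (words n) (preimages f x0 n)) \<and>
     (\<forall>w. {z. f_ac f z = lab w} = {lab (w @ [La]), lab (w @ [Lb])} \<and>
          lab (w @ [Lb]) = - lab (w @ [La]))"

abbreviation ac_ring :: "'k::field alg_closure ring" where
  "ac_ring \<equiv> ring_of_type_algebra"

definition K_inf :: "'k::field poly \<Rightarrow> 'k \<Rightarrow> 'k alg_closure set" where
  "K_inf f x0 = (\<Union>n. generate_field ac_ring (range to_ac \<union> preimages f x0 n))"

text \<open>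
  Automorphisms of the extension, as functions on the whole closure that are
  \<^const>\<open>undefined\<close> outside of it.
\<close>

definition Gal_inf ::
    "'k::field poly \<Rightarrow> 'k \<Rightarrow> ('k alg_closure \<Rightarrow> 'k alg_closure) set" where
  "Gal_inf f x0 =
     {\<sigma> \<in> extensional (K_inf f x0).
        \<sigma> \<in> ring_iso (ac_ring\<lparr>carrier := K_inf f x0\<rparr>) (ac_ring\<lparr>carrier := K_inf f x0\<rparr>) \<and>
        (\<forall>k. \<sigma> (to_ac k) = to_ac k)}"

text \<open>The action on words determined by $[\sigma(w)] = \sigma([w])$, level by level.\<close>

definition tree_act ::
    "(word \<Rightarrow> 'k::field alg_closure) \<Rightarrow> ('k alg_closure \<Rightarrow> 'k alg_closure) \<Rightarrow> word \<Rightarrow> word" where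
  "tree_act lab \<sigma> w = (THE v. length v = length w \<and> lab v = \<sigma> (lab w))"


subsection \<open>Labelings adapted to a square root of 2\<close>

definition E_prod :: "nat \<Rightarrow> (word \<Rightarrow> 'k::field alg_closure) \<Rightarrow> word \<Rightarrow> 'k alg_closure" where
  "E_prod r lab y = (\<Prod>w\<in>words (r - 2). lab (y @ w @ [La]))"

definition sqrt2_labeling ::
    "'k::field poly \<Rightarrow> 'k \<Rightarrow> nat \<Rightarrow> 'k alg_closure \<Rightarrow> (word \<Rightarrow> 'k alg_closure) \<Rightarrow> bool" where
  "sqrt2_labeling f x0 r s lab \<longleftrightarrow> is_labeling f x0 lab \<and>
     (\<forall>x. let Eaa = E_prod r lab (x @ [La, La]); Eab = E_prod r lab (x @ [La, Lb]);
              Eba = E_prod r lab (x @ [Lb, La]); Ebb = E_prod r lab (x @ [Lb, Lb])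
          in Eaa * Eab = lab (x @ [Lb, La]) \<and> Eba * Ebb = lab (x @ [La, La]) \<and>
             (Eaa + Eab) / Ebb = s \<and> (Eab - Eaa) / Eba = s \<and>
             (Eba + Ebb) / Eab = s \<and> (Ebb - Eba) / Eaa = s)"

end

theory Submission
  imports Defs
begin

text \<open>
  Write \<open>p\<close> for the \<open>(r - 1)\<close>-st iterate of \<open>0\<close>, so that \<open>p\<^sup>2 + c = - c\<close>. Multiplying over a subtree
  gives \<open>E y ^ 2 = p - [y]\<close>, from which both product relations and all four quotient relations
  hold up to sign. The signs at level \<open>n\<close> are corrected by exchanging sibling subtrees
  below level \<open>n\<close>, which leaves all lower levels untouched, so the corrected labelings converge.
  For the Galois action, \<open>\<sigma> (E y) = \<plusminus> E (\<sigma> y)\<close>, where the sign is the sum of the parities at level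
  \<open>r - 2\<close> above \<open>y\<close>; applying \<open>\<sigma>\<close> to the product relations yields the values of \<open>P\<close>, and applying it
  to \<open>sqrt2 * E xbb = E xaa + E xab\<close> yields the value of \<open>R\<close>.
\<close>

subsection \<open>Words and signs\<close>

lemma words_0 [simp]: "words 0 = {[]}"
  by (auto simp: words_def)

lemma words_Suc: "words (Suc n) = (#) La ` words n \<union> (#) Lb ` words n"
proof (intro equalityI subsetI)
  fix w assume "w \<in> words (Suc n)"
  then obtain l v where "w = l # v" "v \<in> words n"
    by (auto simp: words_def length_Suc_conv)
  then show "w \<in> (#) La ` words n \<union> (#) Lb ` words n"
    by (cases l) auto
qed (auto simp: words_def)

lemma finite_words [simp]: "finite (words n)"
  by (induction n) (auto simp: words_Suc)

lemma prod_words_Suc: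
  fixes F :: "word \<Rightarrow> 'a::comm_monoid_mult"
  shows "(\<Prod>w\<in>words (Suc n). F w) = (\<Prod>w\<in>words n. F (La # w)) * (\<Prod>w\<in>words n. F (Lb # w))"
  unfolding words_Suc
  by (subst prod.union_disjoint) (auto simp: prod.reindex)

lemma sum_words_Suc:
  fixes F :: "word \<Rightarrow> 'a::comm_monoid_add"
  shows "(\<Sum>w\<in>words (Suc n). F w) = (\<Sum>w\<in>words n. F (La # w)) + (\<Sum>w\<in>words n. F (Lb # w))"
  unfolding words_Suc
  by (subst sum.union_disjoint) (auto simp: sum.reindex)

text \<open>The character of the two-element group: it turns sums of parities into products of signs
  in any commutative ring.\<close>

definition sgb :: "bit \<Rightarrow> 'a::comm_ring_1" where
  "sgb b = (- 1) ^ of_bit b"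

lemma sgb_0 [simp]: "sgb 0 = 1" and sgb_1 [simp]: "sgb 1 = - 1"
  by (simp_all add: sgb_def)

lemma sgb_add: "sgb (a + b) = sgb a * sgb b"
  by (cases a; cases b) simp_all

lemma sgb_sum: "sgb (\<Sum>x\<in>A. F x) = (\<Prod>x\<in>A. sgb (F x))"
proof (induction A rule: infinite_finite_induct)
  case (insert x A)
  then show ?case
    unfolding sum.insert[OF insert(1,2)] prod.insert[OF insert(1,2)] sgb_add by simp
qed simp_all

text \<open>Outside characteristic 2 a sign determines its parity; parity identities are read off
  equations in the closure this way.\<close>

lemma sgb_cancel:
  assumes "(2::'a::field) \<noteq> 0" "(sgb a :: 'a) * x = sgb b * x" "x \<noteq> 0"
  shows "a = b"
  using assms by (cases a; cases b) (auto simp: eq_neg_iff_add_eq_0 neg_eq_iff_add_eq_0)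

fun flip :: "letter \<Rightarrow> letter" where
  "flip La = Lb"
| "flip Lb = La"


subsection \<open>The four quotients\<close>

text \<open>\<open>A\<close>, \<open>B\<close>, \<open>C\<close>, \<open>D\<close> stand for the
  products \<open>E\<close> at \<open>xaa\<close>, \<open>xab\<close>, \<open>xba\<close>,
  \<open>xbb\<close>, and \<open>u\<close>, \<open>v\<close> for the labels of \<open>xaa\<close>,
  \<open>xba\<close>. Denominators are cleared, so that \<open>\<sigma>\<close> can be applied to
  sums and products only.\<close>

definition sqrt2_pattern :: "'a::field \<Rightarrow> 'a \<Rightarrow> 'a \<Rightarrow> 'a \<Rightarrow> 'a \<Rightarrow> 'a \<Rightarrow> 'a \<Rightarrow> bool" where
  "sqrt2_pattern s A B C D u v \<longleftrightarrow> A * B = v \<and> C * D = u \<and>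
     A + B = s * D \<and> B - A = s * C \<and> C + D = s * B \<and> D - C = s * A"

lemma sqrt2_pattern_altdef:
  assumes "A \<noteq> 0" "B \<noteq> 0" "C \<noteq> 0" "D \<noteq> 0"
  shows "sqrt2_pattern s A B C D u v \<longleftrightarrow> A * B = v \<and> C * D = u \<and>
     (A + B) / D = s \<and> (B - A) / C = s \<and> (C + D) / B = s \<and> (D - C) / A = s"
  using assms by (simp add: sqrt2_pattern_def divide_eq_eq)

text \<open>
  The first quotient squares to 2 and determines the other three; negating both \<open>A\<close> and \<open>B\<close>
  negates all four.
\<close>

lemma sqrt2_pattern_signs:
  fixes A B C D u v p s :: "'a::field"
  assumes two: "(2::'a) \<noteq> 0" and s: "s\<^sup>2 = 2"
    and sq: "A\<^sup>2 = p - u" "B\<^sup>2 = p + u" "C\<^sup>2 = p - v" "D\<^sup>2 = p + v"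
    and prods: "(A * B)\<^sup>2 = v\<^sup>2" "(C * D)\<^sup>2 = u\<^sup>2"
    and nz: "C \<noteq> 0" "D \<noteq> 0"
  shows "\<exists>\<alpha> \<beta> \<delta>. sqrt2_pattern s (sgb \<alpha> * A) (sgb \<beta> * B) C (sgb \<delta> * D) u v"
proof -
  obtain \<beta> :: bit where \<beta>: "A * (sgb \<beta> * B) = v"
    using prods(1) by (metis (no_types, lifting) power2_eq_iff mult.left_commute mult_1 mult_minus1 sgb_0 sgb_1 minus_minus)
  obtain \<delta> :: bit where \<delta>: "C * (sgb \<delta> * D) = u"
    using prods(2) by (metis (no_types, lifting) power2_eq_iff mult.left_commute mult_1 mult_minus1 sgb_0 sgb_1 minus_minus)
  define B' where "B' = sgb \<beta> * B"
  define D' where "D' = sgb \<delta> * D"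
  have B': "B'\<^sup>2 = p + u" "A * B' = v" and D': "D'\<^sup>2 = p + v" "C * D' = u" "D' \<noteq> 0"
    using sq \<beta> \<delta> nz by (cases \<beta>; cases \<delta>; simp add: B'_def D'_def)+
  \<comment> \<open>Both squares equal \<open>2 * p + 2 * v\<close>.\<close>
  have "(A + B')\<^sup>2 = (s * D')\<^sup>2"
    unfolding power_mult_distrib s power2_sum B'(1) sq(1) D'(1) using B'(2) by (simp add: algebra_simps)
  then obtain \<alpha> :: bit where "A + B' = sgb \<alpha> * s * D'"
    by (metis power2_eq_iff mult_1 mult_minus1 mult_minus_left sgb_0 sgb_1)
  then obtain t where t: "A + B' = t * D'" "t = sgb \<alpha> * s" "t\<^sup>2 = 2" "t \<noteq> 0"
    using s two by (cases \<alpha>) fastforce+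
  \<comment> \<open>The difference of squares is \<open>2 * u = t\<^sup>2 * (C * D')\<close>;
    cancelling \<open>t * D'\<close> derives the second relation from the first.\<close>
  have "(B' - A) * (t * D') = B'\<^sup>2 - A\<^sup>2"
    unfolding t(1)[symmetric] by (simp add: power2_eq_square algebra_simps)
  also have "\<dots> = t\<^sup>2 * (C * D')"
    using B'(1) sq(1) D'(2) t(3) by simp
  finally have BA: "B' - A = t * C"
    using t(4) D'(3) by (simp add: power2_eq_square)
  have "t * (C + D') = (B' - A) + (A + B')" "t * (D' - C) = (A + B') - (B' - A)"
    unfolding BA t(1) by (simp_all add: algebra_simps)
  then have "t * (C + D') = t * (t * B')" "t * (D' - C) = t * (t * A)"
    using t(3) by (simp_all add: power2_eq_square flip: mult.assoc)
  then have CD: "C + D' = t * B'" "D' - C = t * A"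
    using t(4) by simp_all
  have "sqrt2_pattern s (sgb \<alpha> * A) (sgb \<alpha> * B') C D' u v"
    unfolding sqrt2_pattern_def
  proof (intro conjI)
    have "sgb \<alpha> * A + sgb \<alpha> * B' = sgb \<alpha> * (t * D')"
      and "sgb \<alpha> * B' - sgb \<alpha> * A = sgb \<alpha> * (t * C)"
      unfolding distrib_left[symmetric] right_diff_distrib[symmetric] t(1) BA by (rule refl)+
    then show "sgb \<alpha> * A + sgb \<alpha> * B' = s * D'" "sgb \<alpha> * B' - sgb \<alpha> * A = s * C"
      by (cases \<alpha>; simp add: t(2))+
  qed (cases \<alpha>; simp add: t(2) CD B'(2) D'(2))+
  then show ?thesis
    unfolding B'_def D'_def mult.assoc[symmetric] sgb_add[symmetric] by blast
qed


subsection \<open>Labelings given by square roots\<close>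

locale pcf_quadratic =
  fixes c x0 :: "'k::field" and r :: nat and s :: "'k alg_closure"
  assumes two: "(2::'k) \<noteq> 0"
    and r_eq: "(poly [:c, 0, 1:] ^^ r) 0 = - c"
    and r_ge: "r \<ge> 3"
    and x0: "\<And>i. (poly [:c, 0, 1:] ^^ i) 0 \<noteq> x0"
    and s: "s\<^sup>2 = 2"
begin

abbreviation f :: "'k poly" where "f \<equiv> [:c, 0, 1:]"

text \<open>The critical orbit, moved to the closure; \<open>crit (r - 1)\<close> is the
  \<open>p\<close> of the outline.\<close>

definition crit :: "nat \<Rightarrow> 'k alg_closure" where
  "crit i = to_ac ((poly f ^^ i) 0)"

lemma two': "(2 :: 'k alg_closure) \<noteq> 0"
  using two by (metis to_ac_eq_0_iff to_ac_numeral)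

lemma f_ac_eq: "f_ac f z = z\<^sup>2 + to_ac c"
  by (simp add: f_ac_def map_poly_pCons power2_eq_square algebra_simps)

lemma crit_Suc: "crit (Suc i) = (crit i)\<^sup>2 + to_ac c"
  by (simp add: crit_def power2_eq_square algebra_simps)

lemma crit_eq_funpow: "(f_ac f ^^ i) 0 = crit i"
  by (induction i) (simp_all add: crit_Suc f_ac_eq, simp add: crit_def)

lemma crit_pred_sq: "(crit (r - 1))\<^sup>2 = - 2 * to_ac c"
proof -
  have "crit (Suc (r - 1)) = - to_ac c"
    using r_ge r_eq by (simp add: crit_def del: funpow.simps)
  then show ?thesis
    unfolding crit_Suc by (simp add: eq_diff_eq[symmetric])
qed

text \<open>Only the local square-root conditions. Bijectivity on each level follows from them
  (\<open>is_labeling_iff\<close>), so after a change of signs only these need rechecking.\<close>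

definition root_labeling :: "(word \<Rightarrow> 'k alg_closure) \<Rightarrow> bool" where
  "root_labeling lab \<longleftrightarrow> lab [] = to_ac x0 \<and>
     (\<forall>w. (lab (w @ [La]))\<^sup>2 = lab w - to_ac c \<and> lab (w @ [Lb]) = - lab (w @ [La]))"

lemma root_labelingD:
  assumes "root_labeling lab"
  shows "lab [] = to_ac x0" "(lab (w @ [l]))\<^sup>2 = lab w - to_ac c" "lab (w @ [Lb]) = - lab (w @ [La])"
    "lab (w @ [flip l]) = - lab (w @ [l])"
  using assms by (cases l; simp add: root_labeling_def)+

lemma funpow_root_labeling:
  assumes "root_labeling lab"
  shows "(f_ac f ^^ length w) (lab w) = to_ac x0"
proof (induction w rule: rev_induct)
  case (snoc l w)
  have "f_ac f (lab (w @ [l])) = lab w"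
    by (simp add: f_ac_eq root_labelingD[OF assms])
  then show ?case
    using snoc by (simp add: funpow_swap1)
qed (simp add: root_labelingD[OF assms])

text \<open>A label \<open>0\<close> would put \<open>x0\<close> on the forward orbit of
  \<open>0\<close>.\<close>

lemma root_labeling_nonzero:
  assumes "root_labeling lab"
  shows "lab w \<noteq> 0"
  using funpow_root_labeling[OF assms, of w] x0[of "length w"]
  by (auto simp: crit_eq_funpow crit_def)

lemma root_labeling_children:
  assumes "root_labeling lab"
  shows "f_ac f z = lab w \<longleftrightarrow> z = lab (w @ [La]) \<or> z = lab (w @ [Lb])"
proof -
  have "f_ac f z = lab w \<longleftrightarrow> z\<^sup>2 = (lab (w @ [La]))\<^sup>2"
    by (auto simp: f_ac_eq root_labelingD(2)[OF assms] algebra_simps)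
  then show ?thesis
    by (simp add: power2_eq_iff root_labelingD(3)[OF assms])
qed

text \<open>Equal labels have parents with equal labels, by squaring; siblings are opposite and
  nonzero, hence distinct because \<open>2\<close> is nonzero.\<close>

lemma root_labeling_inj:
  assumes "root_labeling lab" "length v = length w" "lab v = lab w"
  shows "v = w"
  using assms(2,3)
proof (induction w arbitrary: v rule: rev_induct)
  case (snoc l w)
  then obtain v' l' where v: "v = v' @ [l']" "length v' = length w"
    by (metis length_Suc_conv_rev length_append_singleton)
  have "(lab (v' @ [l']))\<^sup>2 = (lab (w @ [l]))\<^sup>2"
    using snoc.prems(2) v(1) by simp
  then have "lab v' = lab w"
    by (simp add: root_labelingD[OF assms(1)])
  then have "v' = w"
    using snoc.IH v(2) by blast
  moreover have "l' = l"
  proof (rule ccontr)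
    assume "l' \<noteq> l"
    then have "l' = flip l"
      by (cases l; cases l') simp_all
    then have "- lab (w @ [l]) = lab (w @ [l])"
      using snoc.prems(2) v(1) \<open>v' = w\<close> root_labelingD(4)[OF assms(1)] by metis
    then show False
      using root_labeling_nonzero[OF assms(1), of "w @ [l]"] two'
      by (simp add: neg_eq_iff_add_eq_0 flip: mult_2)
  qed
  ultimately show ?case
    using v(1) by simp
qed simp

lemma root_labeling_surj:
  assumes "root_labeling lab"
  shows "z \<in> preimages f x0 n \<Longrightarrow> \<exists>w\<in>words n. lab w = z"
proof (induction n arbitrary: z)
  case 0
  then show ?case
    by (simp add: preimages_def root_labelingD[OF assms])
next
  case (Suc n)
  then have "f_ac f z \<in> preimages f x0 n"
    by (simp add: preimages_def funpow_swap1)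
  then obtain w where w: "w \<in> words n" "f_ac f z = lab w"
    using Suc.IH by metis
  then obtain l where "z = lab (w @ [l])"
    using root_labeling_children[OF assms] by blast
  then show ?case
    using w(1) by (intro bexI[of _ "w @ [l]"]) (auto simp: words_def)
qed

lemma is_labeling_iff: "is_labeling f x0 lab \<longleftrightarrow> root_labeling lab"
proof
  assume lab: "is_labeling f x0 lab"
  have "(lab (w @ [La]))\<^sup>2 = lab w - to_ac c" for w
  proof -
    have "lab (w @ [La]) \<in> {z. f_ac f z = lab w}"
      using lab unfolding is_labeling_def by blast
    then show ?thesis
      by (simp add: f_ac_eq eq_diff_eq)
  qed
  with lab show "root_labeling lab"
    unfolding is_labeling_def root_labeling_def by blast
next
  assume lab: "root_labeling lab"
  have "bij_betw lab (words n) (preimages f x0 n)" for n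
    unfolding bij_betw_def
  proof (intro conjI equalityI subsetI)
    show "inj_on lab (words n)"
      by (auto intro!: inj_onI root_labeling_inj[OF lab] simp: words_def)
  next
    fix z assume "z \<in> lab ` words n"
    then show "z \<in> preimages f x0 n"
      using funpow_root_labeling[OF lab] by (auto simp: preimages_def words_def)
  next
    fix z assume "z \<in> preimages f x0 n"
    then show "z \<in> lab ` words n"
      using root_labeling_surj[OF lab] by blast
  qed
  moreover have "{z. f_ac f z = lab w} = {lab (w @ [La]), lab (w @ [Lb])}" for w
    using root_labeling_children[OF lab] by blast
  ultimately show "is_labeling f x0 lab"
    using root_labelingD[OF lab] by (simp add: is_labeling_def)
qed

lemma root_labeling_exists: "\<exists>lab. root_labeling lab"
proof -
  obtain q :: "'k alg_closure \<Rightarrow> 'k alg_closure" where q: "\<And>z. (q z)\<^sup>2 = z"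
    using choice[of "\<lambda>z w. w\<^sup>2 = z"] nth_root_exists[of 2] by auto
  \<comment> \<open>\<open>rec_list\<close> recurses at the head while words grow at the end, hence
    the reversal of \<open>w\<close>.\<close>
  define L where "L = rec_list (to_ac x0) (\<lambda>l _ z. (case l of La \<Rightarrow> 1 | Lb \<Rightarrow> - 1) * q (z - to_ac c))"
  have "root_labeling (\<lambda>w. L (rev w))"
    by (simp add: root_labeling_def L_def q)
  then show ?thesis
    by blast
qed


subsection \<open>The products \<open>E\<close>\<close>

lemma E_nonzero:
  assumes "root_labeling lab"
  shows "E_prod r lab y \<noteq> 0"
  by (simp add: E_prod_def root_labeling_nonzero[OF assms])

text \<open>Children have labels \<open>z\<close> and \<open>- z\<close>, so each step multiplies
  \<open>p - z\<close> by \<open>p + z\<close> and applies \<open>f\<close> to \<open>p\<close>. At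
  depth zero the square is \<open>lab y - to_ac c\<close>, with the opposite sign, so the induction
  starts at depth one; \<open>r - 2\<close> reaches it because \<open>r \<ge> 3\<close>.\<close>

lemma prod_words_sq:
  assumes lab: "root_labeling lab"
  shows "(\<Prod>w\<in>words (Suc n). lab (y @ w @ [La]))\<^sup>2 = crit (Suc (Suc n)) - lab y"
proof (induction n arbitrary: y)
  case 0
  have "(lab (y @ [La, La]))\<^sup>2 = lab (y @ [La]) - to_ac c"
       "(lab (y @ [Lb, La]))\<^sup>2 = lab (y @ [Lb]) - to_ac c"
    using root_labelingD(2)[OF lab, of "y @ [La]" La] root_labelingD(2)[OF lab, of "y @ [Lb]" La]
    by simp_all
  then have "(\<Prod>w\<in>words (Suc 0). lab (y @ w @ [La]))\<^sup>2
      = (lab (y @ [La]) - to_ac c) * (lab (y @ [Lb]) - to_ac c)"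
    by (simp add: prod_words_Suc power_mult_distrib)
  also have "\<dots> = (to_ac c)\<^sup>2 - (lab (y @ [La]))\<^sup>2"
    by (simp add: root_labelingD(3)[OF lab] power2_eq_square algebra_simps)
  also have "\<dots> = crit (Suc (Suc 0)) - lab y"
    unfolding root_labelingD(2)[OF lab] by (simp add: crit_def power2_eq_square algebra_simps)
  finally show ?case .
next
  case (Suc n)
  have "(\<Prod>w\<in>words (Suc (Suc n)). lab (y @ w @ [La]))\<^sup>2
      = (crit (Suc (Suc n)) - lab (y @ [La])) * (crit (Suc (Suc n)) - lab (y @ [Lb]))"
    unfolding prod_words_Suc[of _ "Suc n"] power_mult_distrib
    using Suc.IH[of "y @ [La]"] Suc.IH[of "y @ [Lb]"] by simp
  also have "\<dots> = (crit (Suc (Suc n)))\<^sup>2 - (lab (y @ [La]))\<^sup>2"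
    by (simp add: root_labelingD(3)[OF lab] power2_eq_square algebra_simps)
  also have "\<dots> = crit (Suc (Suc (Suc n))) - lab y"
    by (simp add: root_labelingD(2)[OF lab] crit_Suc[of "Suc (Suc n)"])
  finally show ?case .
qed

lemma E_sq:
  assumes "root_labeling lab"
  shows "(E_prod r lab y)\<^sup>2 = crit (r - 1) - lab y"
proof -
  have "Suc (r - 3) = r - 2" "Suc (Suc (r - 3)) = r - 1"
    using r_ge by simp_all
  then show ?thesis
    using prod_words_sq[OF assms, of y "r - 3"] by (simp only: E_prod_def)
qed

text \<open>With \<open>p = crit (r - 1)\<close> this is \<open>p\<^sup>2\<close> minus the square
  of a child label, and \<open>p\<^sup>2 = - 2 * c\<close>. The sibling of \<open>y\<close> has
  label \<open>- lab y\<close>, so the result is the squared label of a child of that sibling: the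
  product relation up to sign.\<close>

lemma E_pair_sq:
  assumes lab: "root_labeling lab"
  shows "(E_prod r lab (y @ [La]) * E_prod r lab (y @ [Lb]))\<^sup>2 = - lab y - to_ac c"
proof -
  have "(E_prod r lab (y @ [La]) * E_prod r lab (y @ [Lb]))\<^sup>2
      = (crit (r - 1))\<^sup>2 - (lab (y @ [La]))\<^sup>2"
    unfolding power_mult_distrib E_sq[OF lab] root_labelingD(3)[OF lab]
    by (simp add: power2_eq_square algebra_simps)
  then show ?thesis
    unfolding crit_pred_sq root_labelingD(2)[OF lab] by simp
qed

definition pattern_at :: "(word \<Rightarrow> 'k alg_closure) \<Rightarrow> word \<Rightarrow> bool" where
  "pattern_at lab x \<longleftrightarrow> sqrt2_pattern s
     (E_prod r lab (x @ [La, La])) (E_prod r lab (x @ [La, Lb]))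
     (E_prod r lab (x @ [Lb, La])) (E_prod r lab (x @ [Lb, Lb]))
     (lab (x @ [La, La])) (lab (x @ [Lb, La]))"

lemma sqrt2_labeling_iff:
  "sqrt2_labeling f x0 r s lab \<longleftrightarrow> root_labeling lab \<and> (\<forall>x. pattern_at lab x)"
  by (auto simp: sqrt2_labeling_def is_labeling_iff Let_def pattern_at_def sqrt2_pattern_altdef E_nonzero)

text \<open>The product at \<open>xba\<close> is kept as the reference for the other three
  signs.\<close>

lemma pattern_signs:
  assumes lab: "root_labeling lab"
  shows "\<exists>\<alpha> \<beta> \<delta>. sqrt2_pattern s
     (sgb \<alpha> * E_prod r lab (x @ [La, La])) (sgb \<beta> * E_prod r lab (x @ [La, Lb]))
     (E_prod r lab (x @ [Lb, La])) (sgb \<delta> * E_prod r lab (x @ [Lb, Lb]))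
     (lab (x @ [La, La])) (lab (x @ [Lb, La]))"
proof (rule sqrt2_pattern_signs[where p = "crit (r - 1)"])
  have b: "lab (x @ [l, Lb]) = - lab (x @ [l, La])" for l
    using root_labelingD(3)[OF lab, of "x @ [l]"] by simp
  then show "(E_prod r lab (x @ [La, La]))\<^sup>2 = crit (r - 1) - lab (x @ [La, La])"
    "(E_prod r lab (x @ [La, Lb]))\<^sup>2 = crit (r - 1) + lab (x @ [La, La])"
    "(E_prod r lab (x @ [Lb, La]))\<^sup>2 = crit (r - 1) - lab (x @ [Lb, La])"
    "(E_prod r lab (x @ [Lb, Lb]))\<^sup>2 = crit (r - 1) + lab (x @ [Lb, La])"
    by (simp_all add: E_sq[OF lab])
  show "(E_prod r lab (x @ [La, La]) * E_prod r lab (x @ [La, Lb]))\<^sup>2 = (lab (x @ [Lb, La]))\<^sup>2"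
    "(E_prod r lab (x @ [Lb, La]) * E_prod r lab (x @ [Lb, Lb]))\<^sup>2 = (lab (x @ [La, La]))\<^sup>2"
    using E_pair_sq[OF lab, of "x @ [La]"] E_pair_sq[OF lab, of "x @ [Lb]"]
      root_labelingD(2)[OF lab, of "x @ [La]" La] root_labelingD(2)[OF lab, of "x @ [Lb]" La]
    by (simp_all add: root_labelingD(3)[OF lab, of x])
qed (use two' s E_nonzero[OF lab] in auto)


subsection \<open>Adjusting a labeling level by level\<close>

text \<open>Exchanges the two subtrees below each node \<open>u\<close> of level \<open>n\<close>
  with \<open>t u = 1\<close>: only the letter at position \<open>n\<close> changes, and longer
  words keep their tails.\<close>

definition twist :: "nat \<Rightarrow> (word \<Rightarrow> bit) \<Rightarrow> word \<Rightarrow> word" where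
  "twist n t w = (if n < length w \<and> t (take n w) = 1 then w[n := flip (w ! n)] else w)"

lemma root_labeling_twist:
  assumes lab: "root_labeling lab"
  shows "root_labeling (lab \<circ> twist n t)"
proof -
  have "(lab (twist n t (w @ [La])))\<^sup>2 = lab (twist n t w) - to_ac c \<and>
     lab (twist n t (w @ [Lb])) = - lab (twist n t (w @ [La]))" for w
  proof -
    consider (lt) "length w < n" | (eq) "length w = n" | (gt) "length w > n"
      by linarith
    then show ?thesis
    proof cases
      case gt
      then have "twist n t (w @ [l]) = twist n t w @ [l]" for l
        by (simp add: twist_def list_update_append nth_append)
      then show ?thesis
        by (simp add: root_labelingD[OF lab])
    qed (auto simp: twist_def root_labelingD[OF lab] list_update_append nth_append)
  qed
  moreover have "twist n t [] = []"
    by (simp add: twist_def)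
  ultimately show ?thesis
    using root_labelingD(1)[OF lab] by (simp add: root_labeling_def)
qed

lemma twist_short: "length w \<le> n \<Longrightarrow> twist n t w = w"
  by (simp add: twist_def)

lemma lab_twist_level:
  assumes "root_labeling lab" "length u = n"
  shows "lab (twist n t (u @ [La])) = sgb (t u) * lab (u @ [La])"
  using assms(2) by (cases "t u") (auto simp: twist_def root_labelingD[OF assms(1)])

lemma E_cong:
  assumes "\<And>w. length w \<le> length y + r - 1 \<Longrightarrow> lab w = lab' w"
  shows "E_prod r lab y = E_prod r lab' y"
  unfolding E_prod_def by (intro prod.cong refl assms) (use r_ge in \<open>auto simp: words_def\<close>)

text \<open>The longest words read are \<open>x @ [i, j] @ w @ [La]\<close> with
  \<open>length w = r - 2\<close>, which gives the bound.\<close>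

lemma pattern_at_cong:
  assumes "\<And>w. length w \<le> length x + r + 1 \<Longrightarrow> lab w = lab' w"
  shows "pattern_at lab x \<longleftrightarrow> pattern_at lab' x"
proof -
  have "E_prod r lab (x @ [i, j]) = E_prod r lab' (x @ [i, j])"
    and "lab (x @ [i, j]) = lab' (x @ [i, j])" for i j
    using r_ge by (auto intro!: E_cong assms)
  then show ?thesis
    by (simp add: pattern_at_def)
qed

text \<open>Each \<open>E y\<close> gets its sign from the single node \<open>y @ replicate (r - 2) La\<close>.\<close>

lemma E_twist:
  assumes lab: "root_labeling lab"
    and y: "length y + (r - 2) = n"
    and t: "t = (\<lambda>u. if drop (n - (r - 2)) u = replicate (r - 2) La then \<eta> (take (n - (r - 2)) u) else 0)"
  shows "E_prod r (lab \<circ> twist n t) y = sgb (\<eta> y) * E_prod r lab y"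
proof -
  let ?v = "replicate (r - 2) La"
  have n: "n - (r - 2) = length y"
    using y by simp
  have "lab (twist n t (y @ w @ [La])) = (if w = ?v then sgb (\<eta> y) else 1) * lab (y @ w @ [La])"
    if "w \<in> words (r - 2)" for w
    using lab_twist_level[OF lab, of "y @ w" n t] that y by (simp add: words_def t n)
  then have "E_prod r (lab \<circ> twist n t) y
      = (\<Prod>w\<in>words (r - 2). if w = ?v then sgb (\<eta> y) else 1) * E_prod r lab y"
    unfolding E_prod_def comp_def by (simp add: prod.distrib)
  moreover have "?v \<in> words (r - 2)"
    by (simp add: words_def)
  ultimately show ?thesis
    by (simp add: prod.delta)
qed

text \<open>A twist at level \<open>n\<close> changes labels from level \<open>n + 1\<close> on.
  Patterns at shorter \<open>x\<close> do not reach that far; for \<open>length x + r = n\<close>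
  the factors of the four products lie exactly at level \<open>n + 1\<close>, so all these patterns
  can be corrected at once.\<close>

lemma adjust_level:
  assumes lab: "root_labeling lab"
    and pat: "\<And>x. length x + r < n \<Longrightarrow> pattern_at lab x"
  obtains lab' where "root_labeling lab'" "\<And>x. length x + r < Suc n \<Longrightarrow> pattern_at lab' x"
    "\<And>w. length w \<le> n \<Longrightarrow> lab' w = lab w"
proof -
  obtain \<alpha> \<beta> \<delta> where signs: "\<And>x. sqrt2_pattern s
     (sgb (\<alpha> x) * E_prod r lab (x @ [La, La])) (sgb (\<beta> x) * E_prod r lab (x @ [La, Lb]))
     (E_prod r lab (x @ [Lb, La])) (sgb (\<delta> x) * E_prod r lab (x @ [Lb, Lb]))
     (lab (x @ [La, La])) (lab (x @ [Lb, La]))"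
    using pattern_signs[OF lab] by metis
  \<comment> \<open>\<open>butlast (butlast y)\<close> recovers \<open>x\<close> from
    \<open>x @ [i, j]\<close>; the value \<open>0\<close> at \<open>xba\<close> is the sign that
    \<open>pattern_signs\<close> leaves alone.\<close>
  define \<eta> where "\<eta> y = (let x = butlast (butlast y) in
     if y = x @ [La, La] then \<alpha> x else if y = x @ [La, Lb] then \<beta> x
     else if y = x @ [Lb, Lb] then \<delta> x else 0)" for y :: word
  define t where
    "t = (\<lambda>u. if drop (n - (r - 2)) u = replicate (r - 2) La then \<eta> (take (n - (r - 2)) u) else 0)"
  have \<eta>: "\<eta> (x @ [La, La]) = \<alpha> x" "\<eta> (x @ [La, Lb]) = \<beta> x" "\<eta> (x @ [Lb, La]) = 0"
    "\<eta> (x @ [Lb, Lb]) = \<delta> x" for x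
    by (simp_all add: \<eta>_def butlast_append)
  have "pattern_at (lab \<circ> twist n t) x" if "length x + r < Suc n" for x
  proof (cases "length x + r = n")
    case True
    then have "length (x @ [i, j]) + (r - 2) = n" "length (x @ [i, j]) \<le> n" for i j
      using r_ge by simp_all
    then have "E_prod r (lab \<circ> twist n t) (x @ [i, j]) = sgb (\<eta> (x @ [i, j])) * E_prod r lab (x @ [i, j])"
      and "(lab \<circ> twist n t) (x @ [i, j]) = lab (x @ [i, j])" for i j
      by (simp_all add: E_twist[OF lab _ t_def] twist_short del: length_append)
    then show ?thesis
      using signs[of x] by (simp add: pattern_at_def \<eta>)
  next
    case False
    then have "length x + r < n"
      using that by simp
    then show ?thesis
      using pat[of x] by (subst pattern_at_cong[where lab' = lab]) (simp_all add: twist_short)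
  qed
  then show ?thesis
    using that[of "lab \<circ> twist n t"] root_labeling_twist[OF lab] by (simp add: twist_short)
qed

lemma sqrt2_labeling_exists: "\<exists>lab. sqrt2_labeling f x0 r s lab"
proof -
  have "\<exists>L. \<forall>n. (root_labeling (L n) \<and> (\<forall>x. length x + r < n \<longrightarrow> pattern_at (L n) x)) \<and>
      (\<forall>w. length w \<le> n \<longrightarrow> L (Suc n) w = L n w)"
  proof (rule dependent_nat_choice)
    show "\<exists>lab. root_labeling lab \<and> (\<forall>x. length x + r < 0 \<longrightarrow> pattern_at lab x)"
      using root_labeling_exists by simp
  qed (metis adjust_level)
  then obtain L where L: "\<And>n. root_labeling (L n)"
    "\<And>n x. length x + r < n \<Longrightarrow> pattern_at (L n) x"
    "\<And>n w. length w \<le> n \<Longrightarrow> L (Suc n) w = L n w"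
    by blast
  \<comment> \<open>Diagonal limit: labels of level at most \<open>n\<close> no longer change from
    stage \<open>n\<close> on.\<close>
  define lab where "lab w = L (length w) w" for w
  have lab: "lab w = L n w" if "length w \<le> n" for n w
    using that by (induction n rule: dec_induct) (simp_all add: lab_def L(3))
  have "root_labeling lab"
    unfolding root_labeling_def
  proof (intro conjI allI)
    show "lab [] = to_ac x0"
      by (simp add: lab_def root_labelingD[OF L(1)])
  next
    fix w
    have *: "lab w = L (Suc (length w)) w" "lab (w @ [l]) = L (Suc (length w)) (w @ [l])" for l
      by (simp_all add: lab)
    show "(lab (w @ [La]))\<^sup>2 = lab w - to_ac c" "lab (w @ [Lb]) = - lab (w @ [La])"
      unfolding * by (rule root_labelingD[OF L(1)])+
  qed
  moreover have "pattern_at lab x" for x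
    using L(2)[of x "length x + r + 1"] pattern_at_cong[of x lab "L (length x + r + 1)"]
    by (simp add: lab)
  ultimately show ?thesis
    using sqrt2_labeling_iff by blast
qed

lemma K_inf_level:
  assumes "z \<in> generate_field ac_ring (range to_ac \<union> preimages f x0 n)"
  shows "z \<in> K_inf f x0"
  using assms by (auto simp: K_inf_def)

end


subsection \<open>The Galois action\<close>

lemma ac_ring_simps:
  "carrier ac_ring = UNIV" "x \<otimes>\<^bsub>ac_ring\<^esub> y = x * y" "x \<oplus>\<^bsub>ac_ring\<^esub> y = x + y"
  "\<one>\<^bsub>ac_ring\<^esub> = 1" "\<zero>\<^bsub>ac_ring\<^esub> = 0"
  by (simp_all add: ring_of_type_algebra_def)

lemma ac_ring_inv:
  assumes "x \<noteq> 0"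
  shows "inv\<^bsub>ac_ring\<^esub> x = inverse x"
proof -
  interpret F: Ring.field "ac_ring :: 'a alg_closure ring"
    by (rule field_from_type_algebra)
  show ?thesis
    by (rule F.comm_inv_char) (use assms in \<open>simp_all add: ac_ring_simps\<close>)
qed

locale pcf_galois = pcf_quadratic c x0 r s
  for c x0 :: "'k::field" and r :: nat and s :: "'k alg_closure" +
  fixes lab :: "word \<Rightarrow> 'k alg_closure" and \<sigma> :: "'k alg_closure \<Rightarrow> 'k alg_closure"
  assumes root: "root_labeling lab"
    and pat: "\<And>x. pattern_at lab x"
    and gal: "\<sigma> \<in> Gal_inf f x0"
begin

text \<open>Arguments of \<open>\<sigma>\<close> are kept in a single \<open>L n\<close>, closed
  under the field operations by construction; the union \<open>K_inf\<close> enters only through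
  \<open>K_inf_level\<close>.\<close>

abbreviation L :: "nat \<Rightarrow> 'k alg_closure set" where
  "L n \<equiv> generate_field ac_ring (range to_ac \<union> preimages f x0 n)"

abbreviation g :: "word \<Rightarrow> word" where "g \<equiv> tree_act lab \<sigma>"

abbreviation E :: "word \<Rightarrow> 'k alg_closure" where "E \<equiv> E_prod r lab"

lemma L_const: "to_ac k \<in> L n"
  by (auto intro: generate_field.incl)

lemma L_lab: "lab w \<in> L (length w)"
  using funpow_root_labeling[OF root, of w] by (auto intro!: generate_field.incl simp: preimages_def)

lemma L_mult: "x \<in> L n \<Longrightarrow> y \<in> L n \<Longrightarrow> x * y \<in> L n"
  and L_add: "x \<in> L n \<Longrightarrow> y \<in> L n \<Longrightarrow> x + y \<in> L n"
  using generate_field.eng_mult[of x ac_ring _ y] generate_field.eng_add[of x ac_ring _ y]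
  by (simp_all add: ac_ring_simps)

lemma L_divide:
  assumes "x \<in> L n" "y \<in> L n"
  shows "x / y \<in> L n"
proof (cases "y = 0")
  case True
  then show ?thesis
    using L_const[of 0] by simp
next
  case False
  then show ?thesis
    using generate_field.m_inv[of y ac_ring] assms
    by (auto simp: divide_inverse ac_ring_simps ac_ring_inv intro!: L_mult)
qed

lemma L_prod: "(\<And>i. i \<in> A \<Longrightarrow> F i \<in> L n) \<Longrightarrow> (\<Prod>i\<in>A. F i) \<in> L n"
  using L_const[of 1 n] by (induction A rule: infinite_finite_induct) (auto intro: L_mult)

lemma \<sigma>_const: "\<sigma> (to_ac k) = to_ac k"
  using gal by (simp add: Gal_inf_def)

lemma \<sigma>_hom: "\<sigma> \<in> ring_hom (ac_ring\<lparr>carrier := K_inf f x0\<rparr>) (ac_ring\<lparr>carrier := K_inf f x0\<rparr>)"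
  using gal by (simp add: Gal_inf_def ring_iso_def)

lemma \<sigma>_inj: "inj_on \<sigma> (K_inf f x0)"
  using gal by (simp add: Gal_inf_def ring_iso_def bij_betw_def)

lemma \<sigma>_mult: "x \<in> L n \<Longrightarrow> y \<in> L n \<Longrightarrow> \<sigma> (x * y) = \<sigma> x * \<sigma> y"
  using ring_hom_mult[OF \<sigma>_hom, of x y] K_inf_level by (simp add: ac_ring_simps)

lemma \<sigma>_add: "x \<in> L n \<Longrightarrow> y \<in> L n \<Longrightarrow> \<sigma> (x + y) = \<sigma> x + \<sigma> y"
  using ring_hom_add[OF \<sigma>_hom, of x y] K_inf_level by (simp add: ac_ring_simps)

lemma \<sigma>_prod: "(\<And>i. i \<in> A \<Longrightarrow> F i \<in> L n) \<Longrightarrow> \<sigma> (\<Prod>i\<in>A. F i) = (\<Prod>i\<in>A. \<sigma> (F i))"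
proof (induction A rule: infinite_finite_induct)
  case (insert i A)
  then show ?case
    by (simp add: \<sigma>_mult[of _ n] L_prod)
qed (use \<sigma>_const[of 1] in simp_all)

lemma \<sigma>_uminus:
  assumes "x \<in> L n"
  shows "\<sigma> (- x) = - \<sigma> x"
  using \<sigma>_mult[OF L_const[of "- 1"] assms] \<sigma>_const[of "- 1"] by simp

text \<open>\<open>\<sigma>\<close> fixes \<open>c\<close>, so it commutes with \<open>f\<close> on
  labels; hence children go to children.\<close>

lemma \<sigma>_child_sq: "(\<sigma> (lab (w @ [l])))\<^sup>2 + to_ac c = \<sigma> (lab w)"
proof -
  have "lab (w @ [l]) \<in> L (Suc (length w))"
    using L_lab[of "w @ [l]"] by simp
  then have "\<sigma> (lab (w @ [l]) * lab (w @ [l]) + to_ac c) = (\<sigma> (lab (w @ [l])))\<^sup>2 + to_ac c"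
    by (simp add: \<sigma>_add[of _ "Suc (length w)"] \<sigma>_mult[of _ "Suc (length w)"] L_const L_mult \<sigma>_const
        power2_eq_square)
  moreover have "lab (w @ [l]) * lab (w @ [l]) + to_ac c = lab w"
    using root_labelingD(2)[OF root, of w l] by (simp add: power2_eq_square)
  ultimately show ?thesis
    by simp
qed

lemma \<sigma>_lab_exists: "\<exists>v. length v = length w \<and> lab v = \<sigma> (lab w)"
proof (induction w rule: rev_induct)
  case Nil
  then show ?case
    by (simp add: root_labelingD[OF root] \<sigma>_const)
next
  case (snoc l w)
  then obtain v where v: "length v = length w" "lab v = \<sigma> (lab w)"
    by blast
  then have "f_ac f (\<sigma> (lab (w @ [l]))) = lab v"
    by (simp add: f_ac_eq \<sigma>_child_sq)
  then obtain l' where "\<sigma> (lab (w @ [l])) = lab (v @ [l'])"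
    using root_labeling_children[OF root] by blast
  then show ?case
    using v(1) by (intro exI[of _ "v @ [l']"]) simp
qed

section \<open>The tree automorphism induced by \<open>\<sigma>\<close>\<close>

lemma length_g [simp]: "length (g w) = length w"
  and lab_g: "lab (g w) = \<sigma> (lab w)"
proof -
  have "\<exists>!v. length v = length w \<and> lab v = \<sigma> (lab w)"
    using \<sigma>_lab_exists[of w] root_labeling_inj[OF root] by metis
  from theI'[OF this] show "length (g w) = length w" "lab (g w) = \<sigma> (lab w)"
    unfolding tree_act_def by blast+
qed

lemma g_eqI: "length v = length w \<Longrightarrow> lab v = \<sigma> (lab w) \<Longrightarrow> g w = v"
  by (rule root_labeling_inj[OF root]) (simp_all add: lab_g)

definition shift :: "bit \<Rightarrow> letter \<Rightarrow> letter" where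
  "shift b l = (if b = 0 then l else flip l)"

lemma shift_simps [simp]: "shift 0 l = l" "shift 1 l = flip l"
  by (simp_all add: shift_def)

text \<open>The image of the \<open>La\<close> child defines the parity; that of the
  \<open>Lb\<close> child is forced, its label being the negative.\<close>

lemma g_child: "g (w @ [l]) = g w @ [shift (Par g w) l]"
proof -
  have "f_ac f (\<sigma> (lab (w @ [La]))) = lab (g w)"
    by (simp add: f_ac_eq \<sigma>_child_sq lab_g)
  then obtain l' where l': "\<sigma> (lab (w @ [La])) = lab (g w @ [l'])"
    using root_labeling_children[OF root] by blast
  then have a: "g (w @ [La]) = g w @ [l']"
    by (intro g_eqI) simp_all
  have "\<sigma> (lab (w @ [Lb])) = lab (g w @ [flip l'])"
    by (simp add: root_labelingD[OF root] l' \<sigma>_uminus[OF L_lab])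
  then have b: "g (w @ [Lb]) = g w @ [flip l']"
    by (intro g_eqI) simp_all
  show ?thesis
    using a b by (cases l; cases l') (simp_all add: Par_def)
qed

lemma g_Nil [simp]: "g [] = []"
  by (metis length_g length_0_conv)

lemma g_tree_aut: "g \<in> tree_auts"
proof -
  have inj: "inj g"
  proof (rule injI)
    fix v w assume "g v = g w"
    then have "length v = length w" "\<sigma> (lab v) = \<sigma> (lab w)"
      by (metis length_g, metis lab_g)
    then show "v = w"
      using inj_onD[OF \<sigma>_inj] K_inf_level[OF L_lab] root_labeling_inj[OF root] by metis
  qed
  \<comment> \<open>An injective, length-preserving map permutes each finite level, which gives
    surjectivity.\<close>
  have "g ` words n = words n" for n
    by (rule endo_inj_surj) (use inj in \<open>auto simp: words_def inj_on_def\<close>, simp flip: words_def)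
  moreover have "w \<in> words (length w)" for w
    by (simp add: words_def)
  ultimately have "w \<in> range g" for w
    by blast
  then have "bij g"
    using inj by (auto simp: bij_def)
  then show ?thesis
    by (auto simp: tree_auts_def g_child)
qed

text \<open>\<open>g\<close> carries the subtree below \<open>y\<close> onto the one below
  \<open>g y\<close>; in the induction, parity \<open>1\<close> at \<open>y\<close> only swaps the
  two factors.\<close>

lemma prod_words_g: "(\<Prod>w\<in>words n. F (g (y @ w))) = (\<Prod>w\<in>words n. F (g y @ w))"
  for F :: "word \<Rightarrow> 'b::comm_monoid_mult"
proof (induction n arbitrary: y)
  case (Suc n)
  have "(\<Prod>w\<in>words (Suc n). F (g (y @ w)))
      = (\<Prod>w\<in>words n. F (g (y @ [La]) @ w)) * (\<Prod>w\<in>words n. F (g (y @ [Lb]) @ w))"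
    using Suc.IH[of "y @ [La]"] Suc.IH[of "y @ [Lb]"] by (simp add: prod_words_Suc)
  then show ?case
    by (cases "Par g y") (simp_all add: g_child prod_words_Suc mult.commute)
qed simp

section \<open>Signs of the products \<open>E\<close> under \<open>\<sigma>\<close>\<close>

lemma \<sigma>_lab_La: "\<sigma> (lab (w @ [La])) = sgb (Par g w) * lab (g w @ [La])"
  by (cases "Par g w") (simp_all add: g_child root_labelingD[OF root] flip: lab_g)

definition parity :: "word \<Rightarrow> bit" where
  "parity y = (\<Sum>w\<in>words (r - 2). Par g (y @ w))"

lemma L_E_factor:
  assumes "w \<in> words (r - 2)"
  shows "lab (y @ w @ [La]) \<in> L (length y + r - 1)"
proof -
  have "length (y @ w @ [La]) = length y + r - 1"
    using assms r_ge by (simp add: words_def)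
  then show ?thesis
    using L_lab by metis
qed

lemma L_E: "length y + r - 1 = n \<Longrightarrow> E y \<in> L n"
  unfolding E_prod_def using L_E_factor by (blast intro: L_prod)

text \<open>Each factor contributes the sign of \<open>\<sigma>_lab_La\<close>; reindexing by
  \<open>prod_words_g\<close> reassembles the product at \<open>g y\<close>.\<close>

lemma \<sigma>_E: "\<sigma> (E y) = sgb (parity y) * E (g y)"
proof -
  have "\<sigma> (E y) = (\<Prod>w\<in>words (r - 2). \<sigma> (lab (y @ w @ [La])))"
    unfolding E_prod_def by (rule \<sigma>_prod[OF L_E_factor])
  also have "\<dots> = (\<Prod>w\<in>words (r - 2). sgb (Par g (y @ w)) * lab (g (y @ w) @ [La]))"
    using \<sigma>_lab_La[of "y @ _"] by simp
  also have "\<dots> = sgb (parity y) * E (g y)"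
    using prod_words_g[of "\<lambda>v. lab (v @ [La])"]
    by (simp add: prod.distrib sgb_sum parity_def E_prod_def)
  finally show ?thesis .
qed

lemma g_grandchild: "g (x @ [i, j]) = g x @ [shift (Par g x) i, shift (Par g (x @ [i])) j]"
  using g_child[of "x @ [i]" j] g_child[of x i] by simp

lemma E_child_prod: "E (x @ [i, La]) * E (x @ [i, Lb]) = lab (x @ [flip i, La])"
  using pat[of x] by (cases i) (simp_all add: pattern_at_def sqrt2_pattern_def)

text \<open>Apply \<open>\<sigma>\<close> to \<open>E_child_prod\<close> and compare with the same relation at \<open>g x\<close>.\<close>

lemma parity_pair: "parity (x @ [i, La]) + parity (x @ [i, Lb]) = Par g (x @ [flip i])"
proof -
  have "\<sigma> (E (x @ [i, La]) * E (x @ [i, Lb])) = \<sigma> (E (x @ [i, La])) * \<sigma> (E (x @ [i, Lb]))"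
    by (rule \<sigma>_mult[of _ "length x + r + 1"]) (use r_ge in \<open>auto intro!: L_E\<close>)
  also have "\<dots> = sgb (parity (x @ [i, La]) + parity (x @ [i, Lb])) *
      (E (g x @ [shift (Par g x) i, La]) * E (g x @ [shift (Par g x) i, Lb]))"
    unfolding \<sigma>_E g_grandchild sgb_add by (cases "Par g (x @ [i])") simp_all
  also have "\<dots> = sgb (parity (x @ [i, La]) + parity (x @ [i, Lb])) *
      lab (g x @ [flip (shift (Par g x) i), La])"
    by (simp only: E_child_prod)
  finally have "sgb (parity (x @ [i, La]) + parity (x @ [i, Lb])) *
      lab (g x @ [flip (shift (Par g x) i), La]) = \<sigma> (lab ((x @ [flip i]) @ [La]))"
    by (simp add: E_child_prod)
  also have "\<dots> = sgb (Par g (x @ [flip i])) * lab (g x @ [shift (Par g x) (flip i), La])"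
    unfolding \<sigma>_lab_La g_child by simp
  also have "shift (Par g x) (flip i) = flip (shift (Par g x) i)"
    by (simp add: shift_def)
  finally show ?thesis
    by (rule sgb_cancel[OF two']) (simp add: root_labeling_nonzero[OF root])
qed

text \<open>Depth \<open>r - 1\<close> below \<open>y\<close> is depth \<open>r - 2\<close> below
  its two children, which turns the sums in \<open>Pa\<close> and \<open>Pb\<close> into those of
  \<open>parity_pair\<close>.\<close>

lemma sum_words_parity: "(\<Sum>w\<in>words (r - 1). Par g (y @ w)) = parity (y @ [La]) + parity (y @ [Lb])"
proof -
  have "r - 1 = Suc (r - 2)"
    using r_ge by simp
  then show ?thesis
    by (simp only: sum_words_Suc parity_def append_assoc append_Cons append_Nil)
qed

text \<open>By \<open>parity_pair\<close> the sum equals the remaining parity, and equal elements of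
  \<open>bit\<close> cancel.\<close>

lemma Pa_0: "Pa r g x = 0"
  using parity_pair[of x La] sum_words_parity[of "x @ [La]"] by (simp add: Pa_def)

lemma Pb_0: "Pb r g x = 0"
  using parity_pair[of x Lb] sum_words_parity[of "x @ [Lb]"] by (simp add: Pb_def)

lemma Rval_eq: "Rval r g x = Par g (x @ [La]) * Par g (x @ [Lb]) + (parity (x @ [La, Lb]) + parity (x @ [Lb, Lb]))"
  by (simp only: Rval_def parity_def sum.distrib append_assoc append_Cons append_Nil)

text \<open>The product term of \<open>Rval\<close> comes from the relation that holds at
  \<open>g x\<close>, the sum from the parities at \<open>xab\<close> and
  \<open>xbb\<close>.\<close>

lemma \<sigma>_s: "\<sigma> s = sgb (Rval r g x) * s"
proof -
  define n where "n = length x + r + 1"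
  have E_L: "E (x @ [i, j]) \<in> L n" for i j
    using r_ge by (auto intro!: L_E simp: n_def)
  \<comment> \<open>Writing \<open>s\<close> as a quotient puts it into \<open>L n\<close>, where
    \<open>\<sigma>\<close> is multiplicative.\<close>
  have "s = (E (x @ [La, La]) + E (x @ [La, Lb])) / E (x @ [Lb, Lb])"
    using pat[of x] E_nonzero[OF root] by (simp add: pattern_at_def sqrt2_pattern_def)
  then have s_L: "s \<in> L n"
    using E_L by (auto intro: L_divide L_add)
  define p pa pb where "p = Par g x" and "pa = Par g (x @ [La])" and "pb = Par g (x @ [Lb])"
  define ea eb where "ea = parity (x @ [La, Lb])" and "eb = parity (x @ [Lb, Lb])"
  define D where "D = E (g x @ [shift p Lb, shift pb Lb])"
  \<comment> \<open>The signs at \<open>xaa\<close> and \<open>xab\<close> differ by the parity at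
    \<open>xb\<close>.\<close>
  have eaa: "parity (x @ [La, La]) = ea + pb"
    using parity_pair[of x La] unfolding ea_def pb_def
    by (cases "parity (x @ [La, La])"; cases "parity (x @ [La, Lb])"; simp)
  have "\<sigma> s * \<sigma> (E (x @ [Lb, Lb])) = \<sigma> (s * E (x @ [Lb, Lb]))"
    using \<sigma>_mult[OF s_L E_L] by simp
  also have "s * E (x @ [Lb, Lb]) = E (x @ [La, La]) + E (x @ [La, Lb])"
    using pat[of x] by (simp add: pattern_at_def sqrt2_pattern_def)
  also have "\<sigma> \<dots> = \<sigma> (E (x @ [La, La])) + \<sigma> (E (x @ [La, Lb]))"
    by (rule \<sigma>_add) (rule E_L)+
  also have "\<dots> = sgb ea * (sgb pb * E (g x @ [shift p La, shift pa La]) + E (g x @ [shift p La, shift pa Lb]))"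
    unfolding \<sigma>_E g_grandchild eaa sgb_add
    by (simp add: ea_def pa_def p_def algebra_simps)
  \<comment> \<open>One of the four relations at \<open>g x\<close>: \<open>pb\<close> decides
    between sum and difference, \<open>p\<close> picks the branch, and the difference is reversed
    exactly when also \<open>pa = 1\<close>, whence the sign of \<open>pa * pb\<close>.\<close>
  also have "sgb pb * E (g x @ [shift p La, shift pa La]) + E (g x @ [shift p La, shift pa Lb])
      = sgb (pa * pb) * s * D"
    using pat[of "g x"] unfolding D_def pattern_at_def sqrt2_pattern_def
    by (cases p; cases pa; cases pb; simp) (metis minus_diff_eq add.commute uminus_add_conv_diff mult_minus_left)+
  also have "\<sigma> (E (x @ [Lb, Lb])) = sgb eb * D"
    by (simp add: \<sigma>_E g_grandchild eb_def D_def p_def pb_def)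
  finally have "\<sigma> s * sgb eb = sgb ea * sgb (pa * pb) * s"
    using E_nonzero[OF root] by (simp add: D_def)
  then have "\<sigma> s * sgb eb * sgb eb = sgb ea * sgb (pa * pb) * s * sgb eb"
    by simp
  moreover have "\<sigma> s * sgb eb * sgb eb = \<sigma> s"
    by (cases eb) simp_all
  ultimately show ?thesis
    unfolding Rval_eq sgb_add pa_def[symmetric] pb_def[symmetric] ea_def[symmetric] eb_def[symmetric]
    by (simp only: mult_ac)
qed

section \<open>Membership in \<open>M_tilde\<close> and \<open>B_tilde\<close>\<close>

lemma Rval_const: "Rval r g x = Rval r g []"
proof (rule sgb_cancel[OF two'])
  \<comment> \<open>Both sides equal \<open>\<sigma> s\<close>, which does not depend on
    \<open>x\<close>.\<close>
  show "sgb (Rval r g x) * s = sgb (Rval r g []) * s"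
    by (simp flip: \<sigma>_s)
  show "s \<noteq> 0"
    using s two' by auto
qed

lemma g_M_tilde: "g \<in> M_tilde r"
proof -
  have "g \<in> M_grp r"
    using g_tree_aut Pa_0 Pb_0 by (simp add: M_grp_def)
  moreover have "P_common r g = 0"
    unfolding P_common_def by (rule the_equality) (simp_all add: Pa_0 Pb_0)
  ultimately show ?thesis
    using Rval_const by (auto simp: M_tilde_def B_grp_def)
qed

text \<open>An \<open>s\<close> from \<open>K\<close> is fixed by \<open>\<sigma>\<close>, so its
  sign is trivial.\<close>

lemma g_B_tilde:
  assumes "s \<in> range to_ac"
  shows "g \<in> B_tilde r"
proof -
  have "sgb (Rval r g []) * s = sgb 0 * s"
    using assms \<sigma>_s[of "[]"] \<sigma>_const by auto
  moreover have "s \<noteq> 0"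
    using s two' by auto
  ultimately have "Rval r g [] = 0"
    using sgb_cancel[OF two'] by blast
  then have "R_common r g = 0"
    unfolding R_common_def using Rval_const by (intro the_equality) auto
  then show ?thesis
    using g_M_tilde by (simp add: B_tilde_def)
qed

end

theorem theorem5p6:
  fixes c x0 :: "'k::field" and f :: "'k poly" and r :: nat and sqrt2 :: "'k alg_closure"
  assumes char: "CHAR('k) \<noteq> 2"
    and f: "f = [:c, 0, 1:]"
    and not_periodic: "\<forall>n\<ge>1. (poly f ^^ n) 0 \<noteq> 0"
    and r_gt: "r > 1"
    and r_eq: "(poly f ^^ r) 0 = - poly f 0"
    and r_min: "\<forall>m. 1 < m \<and> m < r \<longrightarrow> (poly f ^^ m) 0 \<noteq> - poly f 0"
    and r_ge: "r \<ge> 3"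
    and x0: "\<forall>i. (poly f ^^ i) 0 \<noteq> x0"
    and sqrt2: "sqrt2\<^sup>2 = 2"
  shows "(\<exists>lab. sqrt2_labeling f x0 r sqrt2 lab) \<and>
    (\<forall>lab. sqrt2_labeling f x0 r sqrt2 lab \<longrightarrow>
       (\<forall>x. \<forall>\<sigma>\<in>Gal_inf f x0.
          Pa r (tree_act lab \<sigma>) x = 0 \<and> Pb r (tree_act lab \<sigma>) x = 0 \<and>
          \<sigma> sqrt2 = (- 1) ^ of_bit (Rval r (tree_act lab \<sigma>) x) * sqrt2) \<and>
       tree_act lab ` Gal_inf f x0 \<subseteq> M_tilde r \<and>
       (sqrt2 \<in> range to_ac \<longrightarrow> tree_act lab ` Gal_inf f x0 \<subseteq> B_tilde r))"
proof -
  have "(2::'k) \<noteq> 0"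
  proof
    assume "(2::'k) = 0"
    then have "CHAR('k) dvd 2"
      using of_nat_eq_0_iff_char_dvd[where 'a = 'k, of 2] by simp
    then have "CHAR('k) \<le> 2" "CHAR('k) \<noteq> 0"
      using dvd_imp_le[of "CHAR('k)" 2] by (auto intro: ccontr)
    then show False
      using char CHAR_not_1[where 'a = 'k] by linarith
  qed
  \<comment> \<open>\<open>- poly f 0\<close> evaluates to \<open>- c\<close>, the form that the
    locale requires.\<close>
  then interpret pcf_quadratic c x0 r sqrt2
    using r_eq r_ge x0 sqrt2 by unfold_locales (simp_all add: f)
  show ?thesis
    unfolding f
  proof (intro conjI allI impI ballI subsetI)
    show "\<exists>lab. sqrt2_labeling [:c, 0, 1:] x0 r sqrt2 lab"
      by (rule sqrt2_labeling_exists)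
  next
    fix lab x \<sigma>
    assume "sqrt2_labeling [:c, 0, 1:] x0 r sqrt2 lab" "\<sigma> \<in> Gal_inf [:c, 0, 1:] x0"
    then interpret pcf_galois c x0 r sqrt2 lab \<sigma>
      by unfold_locales (auto simp: sqrt2_labeling_iff)
    show "Pa r (tree_act lab \<sigma>) x = 0" "Pb r (tree_act lab \<sigma>) x = 0"
      "\<sigma> sqrt2 = (- 1) ^ of_bit (Rval r (tree_act lab \<sigma>) x) * sqrt2"
      using Pa_0 Pb_0 \<sigma>_s[of x] by (simp_all add: sgb_def)
  next
    fix lab h
    assume "sqrt2_labeling [:c, 0, 1:] x0 r sqrt2 lab" "h \<in> tree_act lab ` Gal_inf [:c, 0, 1:] x0"
    then obtain \<sigma> where h: "h = tree_act lab \<sigma>" and "pcf_galois c x0 r sqrt2 lab \<sigma>"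
      by (auto simp: sqrt2_labeling_iff pcf_galois_def pcf_galois_axioms_def pcf_quadratic_axioms)
    then interpret pcf_galois c x0 r sqrt2 lab \<sigma>
      by blast
    show "h \<in> M_tilde r"
      using g_M_tilde h by simp
    show "h \<in> B_tilde r" if "sqrt2 \<in> range to_ac"
      using g_B_tilde[OF that] h by simp
  qed
qed

end
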